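(* For every $n\ge 1$, the map $\Phi:\mathcal I_n\to\mathrm{Par}_n$ is a bijection, and its inverse is the map $K:\mathrm{Par}_n\to\mathcal I_n$.
   Context: For integers $a\le b$ write $[a,b]=\{i\in\mathbb Z: a\le i\le b\}$. The set of inversion tables of length $n$ is $\mathcal I_n=[0,0]\times[0,1]\times\cdots\times[0,n-1]$, i.e. sequences $(x_1,\dots,x_n)$ of integers with $0\le x_\ell\le \ell-1$. Let $X$ be a finite set of positive integers. A partition matrix on $X$ is a square upper triangular matrix whose entries are subsets of $X$ such that: (i) every row and every column contains at least one non-empty entry; (ii) the non-empty entries form a partition of $X$ (pairwise disjoint with union $X$); (iii) for all $i,j\in X$, $\mathrm{col}(i)<\mathrm{col}(j)$ implies $i<j$, where $\mathrm{col}(i)$ denotes the index of the column of the entry containing $i$ (similarly $\mathrm{row}(i)$). $\mathrm{Par}_n$ is the set of partition matrices on $[1,n]$. For $w=(x_1,\dots,x_n)\in\mathcal I_n$ let $\mathrm{Alph}(w)=\{y_1<y_2<\dots<y_k\}$ be the set of distinct entries of $w$, and put $y_{k+1}=n$. Then $\Phi(w)$ is the $k\times k$ matrix whose $(i,j)$ entry is $\{\ell\in[1,n]: x_\ell=y_i \text{ and } y_j<\ell\le y_{j+1}\}$. For $A\in\mathrm{Par}_n$, $K(A)=(x_1,\dots,x_n)$ where $x_\ell=\min(A_{\ast i})-1$, $i$ being the row of $A$ containing $\ell$ and $\min(A_{\ast i})$ the smallest element of the union of the entries in column $i$ of $A$. *)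

theory Defs
  imports "Jordan_Normal_Form.Matrix" "HOL-Library.Disjoint_Sets"
begin

text \<open>A sequence \<open>(x\<^sub>1, \<dots>, x\<^sub>n)\<close> is the list \<open>w\<close> with \<open>x\<^sub>l = w ! (l - 1)\<close>.
  Matrix rows and columns are indexed from \<open>0\<close>, following the matrix library.\<close>

definition inv_tables :: "nat \<Rightarrow> nat list set" where
  "inv_tables n = {w. length w = n \<and> (\<forall>l\<in>{1..n}. w ! (l - 1) \<le> l - 1)}"

definition row_of :: "nat set mat \<Rightarrow> nat \<Rightarrow> nat" where
  "row_of A l = (THE i. i < dim_row A \<and> (\<exists>j<dim_col A. l \<in> A $$ (i, j)))"

definition col_of :: "nat set mat \<Rightarrow> nat \<Rightarrow> nat" where
  "col_of A l = (THE j. j < dim_col A \<and> (\<exists>i<dim_row A. l \<in> A $$ (i, j)))"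

definition col_union :: "nat set mat \<Rightarrow> nat \<Rightarrow> nat set" where
  "col_union A j = (\<Union>i<dim_row A. A $$ (i, j))"

text \<open>The library predicate for upper triangular matrices compares entries with \<open>0\<close>;
  here the entries below the diagonal have to be the empty set.\<close>

definition partition_matrix :: "nat set \<Rightarrow> nat set mat \<Rightarrow> bool" where
  "partition_matrix X A \<longleftrightarrow>
     finite X \<and> 0 \<notin> X \<and>
     square_mat A \<and>
     (\<forall>i<dim_row A. \<forall>j<i. A $$ (i, j) = {}) \<and>
     (\<forall>i<dim_row A. \<exists>j<dim_col A. A $$ (i, j) \<noteq> {}) \<and>
     (\<forall>j<dim_col A. \<exists>i<dim_row A. A $$ (i, j) \<noteq> {}) \<and>
     disjoint_family_on (\<lambda>p. A $$ p) ({..<dim_row A} \<times> {..<dim_col A}) \<and>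
     (\<Union>p\<in>{..<dim_row A} \<times> {..<dim_col A}. A $$ p) = X \<and>
     (\<forall>a\<in>X. \<forall>b\<in>X. col_of A a < col_of A b \<longrightarrow> a < b)"

definition Par :: "nat \<Rightarrow> nat set mat set" where
  "Par n = {A. partition_matrix {1..n} A}"

definition Phi :: "nat list \<Rightarrow> nat set mat" where
  "Phi w =
     (let n = length w;
          k = card (set w);
          y = sorted_list_of_set (set w) @ [n]
      in mat k k (\<lambda>(i, j). {l \<in> {1..n}. w ! (l - 1) = y ! i \<and> y ! j < l \<and> l \<le> y ! (j + 1)}))"

text \<open>The index \<open>row_of A l\<close> of a row is reused as the index of a column. The elements of
  the columns are positive, so the subtraction of \<open>1\<close> does not truncate.\<close>

definition K :: "nat \<Rightarrow> nat set mat \<Rightarrow> nat list" where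
  "K n A = map (\<lambda>l. Min (col_union A (row_of A l)) - 1) [1..<n + 1]"

end

theory Submission imports Defs begin

text \<open>
  For an inversion table with alphabet \<open>y\<^sub>1 < \<dots> < y\<^sub>k\<close> we have \<open>y\<^sub>1 = 0\<close>, so the intervals
  \<open>{y\<^sub>j + 1..y\<^sub>j\<^sub>+\<^sub>1}\<close> partition \<open>{1..n}\<close>; they are the columns of \<open>Phi w\<close>, and the minimum of the
  \<open>j\<close>-th one gives \<open>y\<^sub>j\<close> back. Conversely, the columns of a partition matrix are
  consecutive intervals, determined by their minima. The triangular shape of the matrix
  corresponds to the condition \<open>x\<^sub>l \<le> l - 1\<close>.
\<close>

section \<open>Half-open intervals cut out by a sequence\<close>

lemma interval_index_unique:
  fixes y :: "nat \<Rightarrow> 'a::linorder"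
  assumes mono: "\<And>i j. i \<le> j \<Longrightarrow> j \<le> k \<Longrightarrow> y i \<le> y j"
    and "i < k" "y i < l" "l \<le> y (Suc i)"
    and "j < k" "y j < l" "l \<le> y (Suc j)"
  shows "i = j"
proof (rule ccontr)
  assume "i \<noteq> j"
  then consider "Suc i \<le> j" | "Suc j \<le> i" by linarith
  then show False
  proof cases
    case 1
    then have "y (Suc i) \<le> y j" using mono assms(5) by simp
    then show False using assms by order
  next
    case 2
    then have "y (Suc j) \<le> y i" using mono assms(2) by simp
    then show False using assms by order
  qed
qed

text \<open>A discrete crossing argument: an earlier index works if \<open>l \<le> y k\<close>
  already holds, and otherwise \<open>k\<close> itself does.\<close>

lemma interval_index_exists:
  fixes y :: "nat \<Rightarrow> 'a::linorder"
  assumes "y 0 < l" "l \<le> y k"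
  shows "\<exists>j<k. y j < l \<and> l \<le> y (Suc j)"
  using assms(2)
proof (induction k)
  case 0
  then show ?case using assms(1) by simp
next
  case (Suc k)
  then show ?case by (cases "l \<le> y k") (auto intro: less_SucI)
qed

subsection \<open>Partition matrices\<close>

lemma partition_matrixD:
  assumes "partition_matrix X A"
  shows "dim_col A = dim_row A"
    and "\<And>i j. i < dim_row A \<Longrightarrow> j < i \<Longrightarrow> A $$ (i, j) = {}"
    and "\<And>i. i < dim_row A \<Longrightarrow> \<exists>j<dim_row A. A $$ (i, j) \<noteq> {}"
    and "\<And>j. j < dim_row A \<Longrightarrow> \<exists>i<dim_row A. A $$ (i, j) \<noteq> {}"
    and "disjoint_family_on (\<lambda>p. A $$ p) ({..<dim_row A} \<times> {..<dim_row A})"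
    and "(\<Union>p\<in>{..<dim_row A} \<times> {..<dim_row A}. A $$ p) = X"
    and "\<And>a b. a \<in> X \<Longrightarrow> b \<in> X \<Longrightarrow> col_of A a < col_of A b \<Longrightarrow> a < b"
proof -
  show sq: "dim_col A = dim_row A" using assms unfolding partition_matrix_def by simp
  note P = assms[unfolded partition_matrix_def sq]
  show "\<And>i j. i < dim_row A \<Longrightarrow> j < i \<Longrightarrow> A $$ (i, j) = {}"
    "\<And>i. i < dim_row A \<Longrightarrow> \<exists>j<dim_row A. A $$ (i, j) \<noteq> {}"
    "\<And>j. j < dim_row A \<Longrightarrow> \<exists>i<dim_row A. A $$ (i, j) \<noteq> {}"
    "disjoint_family_on (\<lambda>p. A $$ p) ({..<dim_row A} \<times> {..<dim_row A})"
    "(\<Union>p\<in>{..<dim_row A} \<times> {..<dim_row A}. A $$ p) = X"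
    "\<And>a b. a \<in> X \<Longrightarrow> b \<in> X \<Longrightarrow> col_of A a < col_of A b \<Longrightarrow> a < b"
    using P by simp_all
qed

lemma partition_matrix_index_unique:
  assumes "partition_matrix X A"
    and "i < dim_row A" "j < dim_row A" "l \<in> A $$ (i, j)"
    and "i' < dim_row A" "j' < dim_row A" "l \<in> A $$ (i', j')"
  shows "i = i' \<and> j = j'"
proof (rule ccontr)
  assume "\<not> (i = i' \<and> j = j')"
  then have "A $$ (i, j) \<inter> A $$ (i', j') = {}"
    using disjoint_family_onD[OF partition_matrixD(5)[OF assms(1)], of "(i, j)" "(i', j')"] assms
    by simp
  then show False using assms by blast
qed

text \<open>\<open>row_of\<close> and \<open>col_of\<close> are definite descriptions and need a
  unique position. Uniqueness is a hypothesis here, so that the lemma also applies to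
  \<open>Phi w\<close> while the column order of \<open>Phi w\<close>, itself phrased with
  \<open>col_of\<close>, is still being proved.\<close>

lemma row_col_of_eq:
  assumes "square_mat A"
    and unique: "\<And>i' j'. i' < dim_row A \<Longrightarrow> j' < dim_row A \<Longrightarrow> l \<in> A $$ (i', j') \<Longrightarrow> i' = i \<and> j' = j"
    and "i < dim_row A" "j < dim_row A" "l \<in> A $$ (i, j)"
  shows "row_of A l = i" "col_of A l = j"
proof -
  have sq: "dim_col A = dim_row A" using assms(1) by simp
  show "row_of A l = i" "col_of A l = j"
    unfolding row_of_def col_of_def sq by (rule the_equality; use assms(2-) in blast)+
qed

text \<open>This encodes the entries by two functions on \<open>X\<close>, so that later arguments
  about partition matrices are about \<open>row_of\<close> and \<open>col_of\<close> only.\<close>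

lemma partition_matrix_mem_iff:
  assumes A: "partition_matrix X A" and "i < dim_row A" "j < dim_row A"
  shows "l \<in> A $$ (i, j) \<longleftrightarrow> l \<in> X \<and> row_of A l = i \<and> col_of A l = j"
proof -
  have sq: "square_mat A" and X: "(\<Union>p\<in>{..<dim_row A} \<times> {..<dim_row A}. A $$ p) = X"
    using partition_matrixD[OF A] by simp_all
  have rc: "row_of A l = i' \<and> col_of A l = j'"
    if "i' < dim_row A" "j' < dim_row A" "l \<in> A $$ (i', j')" for i' j'
    using row_col_of_eq[OF sq partition_matrix_index_unique[OF A _ _ _ that] that] by simp
  show ?thesis
  proof
    assume "l \<in> A $$ (i, j)"
    then show "l \<in> X \<and> row_of A l = i \<and> col_of A l = j"
      using rc X assms(2,3) by blast
  next
    assume l: "l \<in> X \<and> row_of A l = i \<and> col_of A l = j"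
    then obtain i' j' where "i' < dim_row A" "j' < dim_row A" "l \<in> A $$ (i', j')"
      using X by blast
    then show "l \<in> A $$ (i, j)" using rc l by blast
  qed
qed

lemma partition_matrix_row_col_bounds:
  assumes A: "partition_matrix X A" and "l \<in> X"
  shows "row_of A l \<le> col_of A l" "col_of A l < dim_row A"
proof -
  obtain i j where ij: "i < dim_row A" "j < dim_row A" "l \<in> A $$ (i, j)"
    using partition_matrixD(6)[OF A] assms(2) by blast
  then have "\<not> j < i" using partition_matrixD(2)[OF A] by blast
  then show "row_of A l \<le> col_of A l" "col_of A l < dim_row A"
    using ij partition_matrix_mem_iff[OF A ij(1,2)] by auto
qed

lemma partition_matrix_col_union:
  assumes A: "partition_matrix X A" and "j < dim_row A"
  shows "col_union A j = {l \<in> X. col_of A l = j}"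
  using partition_matrix_mem_iff[OF A _ assms(2)] partition_matrix_row_col_bounds[OF A]
  by (fastforce simp: col_union_def)

lemma partition_matrix_row_nonempty:
  assumes A: "partition_matrix X A" and "i < dim_row A"
  shows "\<exists>l\<in>X. row_of A l = i"
proof -
  obtain j l where "j < dim_row A" "l \<in> A $$ (i, j)"
    using partition_matrixD(3)[OF A assms(2)] by blast
  then show ?thesis using partition_matrix_mem_iff[OF A assms(2)] by blast
qed

lemma partition_matrix_col_nonempty:
  assumes A: "partition_matrix X A" and "j < dim_row A"
  shows "\<exists>l\<in>X. col_of A l = j"
proof -
  obtain i l where "i < dim_row A" "l \<in> A $$ (i, j)"
    using partition_matrixD(4)[OF A assms(2)] by blast
  then show ?thesis using partition_matrix_mem_iff[OF A _ assms(2)] by blast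
qed

subsection \<open>The matrix of an inversion table\<close>

text \<open>The list that \<open>Phi\<close> binds locally as \<open>y\<close>. Indices start at 0:
  \<open>breakpoints w ! i\<close> is the (i+1)-st letter of the alphabet, and the appended length
  closes the last interval.\<close>

definition breakpoints :: "nat list \<Rightarrow> nat list" where
  "breakpoints w = sorted_list_of_set (set w) @ [length w]"

lemma dim_Phi: "dim_row (Phi w) = card (set w)" "dim_col (Phi w) = card (set w)"
  by (simp_all add: Phi_def Let_def)

lemma mem_Phi_iff:
  assumes "i < card (set w)" "j < card (set w)"
  shows "l \<in> Phi w $$ (i, j) \<longleftrightarrow> l \<in> {1..length w} \<and> w ! (l - 1) = breakpoints w ! i \<and>
    breakpoints w ! j < l \<and> l \<le> breakpoints w ! Suc j"
  using assms by (simp add: Phi_def Let_def breakpoints_def)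

lemma inv_tables_entry:
  assumes "w \<in> inv_tables n" "1 \<le> l" "l \<le> n"
  shows "w ! (l - 1) < l"
proof -
  have "w ! (l - 1) \<le> l - 1" using assms unfolding inv_tables_def by auto
  then show ?thesis using assms(2) by linarith
qed

lemma inv_tables_set_less:
  assumes "w \<in> inv_tables n" "x \<in> set w"
  shows "x < n"
proof -
  obtain i where "i < n" "x = w ! i"
    using assms by (auto simp: in_set_conv_nth inv_tables_def)
  then show ?thesis using inv_tables_entry[OF assms(1), of "Suc i"] by simp
qed

lemma breakpoints_last: "breakpoints w ! card (set w) = length w"
  by (simp add: breakpoints_def nth_append)

lemma breakpoints_image: "(\<lambda>i. breakpoints w ! i) ` {..<card (set w)} = set w"
proof -
  have "(\<lambda>i. breakpoints w ! i) ` {..<card (set w)}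
      = (\<lambda>i. sorted_list_of_set (set w) ! i) ` {..<length (sorted_list_of_set (set w))}"
    by (intro image_cong) (simp_all add: breakpoints_def nth_append)
  also have "\<dots> = set w" by (simp only: lessThan_atLeast0 nth_image[OF order_refl]) simp
  finally show ?thesis .
qed

text \<open>The alphabet is listed without repetition, and the final step up to the length is strict
  because all entries of an inversion table are below \<open>n\<close>.\<close>

lemma breakpoints_strict_mono:
  assumes "w \<in> inv_tables n" "i < j" "j \<le> card (set w)"
  shows "breakpoints w ! i < breakpoints w ! j"
proof -
  have "sorted_wrt (<) (breakpoints w)"
    using inv_tables_set_less[OF assms(1)] assms(1)
    by (auto simp: breakpoints_def sorted_wrt_append inv_tables_def)
  then show ?thesis
    using assms(2,3) by (simp add: breakpoints_def sorted_wrt_nth_less)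
qed

lemma breakpoints_mono:
  assumes "w \<in> inv_tables n" "i \<le> j" "j \<le> card (set w)"
  shows "breakpoints w ! i \<le> breakpoints w ! j"
  using breakpoints_strict_mono[OF assms(1) _ assms(3)] assms(2) by (cases "i = j") (auto simp: less_le)

text \<open>The first entry of an inversion table is forced to be 0, so 0 is the least letter. For
  the empty table the only breakpoint is the appended length, again 0.\<close>

lemma breakpoints_0:
  assumes "w \<in> inv_tables n"
  shows "breakpoints w ! 0 = 0"
proof (cases w)
  case Nil
  then show ?thesis by (simp add: breakpoints_def)
next
  case (Cons x xs)
  then have "x = 0" using inv_tables_entry[OF assms, of 1] assms by (auto simp: inv_tables_def)
  then have "0 \<in> set w" using Cons by simp
  then obtain i where "i < card (set w)" "breakpoints w ! i = 0"
    using breakpoints_image[of w] by force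
  then show ?thesis using breakpoints_mono[OF assms, of 0 i] by simp
qed

lemma inv_table_row_exists:
  assumes "w \<in> inv_tables n" "l \<in> {1..n}"
  shows "\<exists>i<card (set w). w ! (l - 1) = breakpoints w ! i"
proof -
  have "w ! (l - 1) \<in> set w" using assms by (auto simp: inv_tables_def)
  then show ?thesis using breakpoints_image[of w] by force
qed

lemma inv_table_col_exists:
  assumes "w \<in> inv_tables n" "l \<in> {1..n}"
  shows "\<exists>j<card (set w). breakpoints w ! j < l \<and> l \<le> breakpoints w ! Suc j"
  using assms breakpoints_last[of w]
  by (intro interval_index_exists) (auto simp: breakpoints_0 inv_tables_def)

section \<open>Positions and columns in \<open>Phi w\<close>\<close>

lemma Phi_index_unique:
  assumes w: "w \<in> inv_tables n"
    and ij: "i < card (set w)" "j < card (set w)" "l \<in> Phi w $$ (i, j)"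
    and ij': "i' < card (set w)" "j' < card (set w)" "l \<in> Phi w $$ (i', j')"
  shows "i = i' \<and> j = j'"
proof
  have "breakpoints w ! i = breakpoints w ! i'"
    using ij ij' by (simp add: mem_Phi_iff)
  then show "i = i'"
    using breakpoints_strict_mono[OF w, of i i'] breakpoints_strict_mono[OF w, of i' i] ij ij'
    by (cases i i' rule: linorder_cases) auto
  show "j = j'"
    using ij ij' breakpoints_mono[OF w]
    by (intro interval_index_unique[of "card (set w)" "\<lambda>i. breakpoints w ! i" j l j'])
      (auto simp: mem_Phi_iff)
qed

text \<open>Each entry of \<open>w\<close> is some letter, so the union over all rows removes the
  row condition and leaves the interval.\<close>

lemma Phi_col_union:
  assumes w: "w \<in> inv_tables n" and "j < card (set w)"
  shows "col_union (Phi w) j = {breakpoints w ! j<..breakpoints w ! Suc j}"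
proof -
  have len: "length w = n" using w by (simp add: inv_tables_def)
  have "breakpoints w ! Suc j \<le> n"
    using breakpoints_mono[OF w, of "Suc j" "card (set w)"] assms(2) by (simp add: breakpoints_last len)
  then have "(\<exists>i<card (set w). l \<in> Phi w $$ (i, j)) \<longleftrightarrow>
      breakpoints w ! j < l \<and> l \<le> breakpoints w ! Suc j" for l
    using assms(2) inv_table_row_exists[OF w, of l] by (auto simp: mem_Phi_iff len cong: conj_cong)
  then show ?thesis by (simp add: set_eq_iff col_union_def dim_Phi Bex_def)
qed

lemma Phi_in_Par:
  assumes w: "w \<in> inv_tables n"
  shows "Phi w \<in> Par n"
proof -
  let ?k = "card (set w)"
  have len: "length w = n" using w by (simp add: inv_tables_def)
  have sq: "square_mat (Phi w)" by (simp add: dim_Phi)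
  have cover: "\<exists>i<?k. \<exists>j<?k. l \<in> Phi w $$ (i, j)" if l: "l \<in> {1..n}" for l
  proof -
    obtain i j where "i < ?k" "w ! (l - 1) = breakpoints w ! i"
      and "j < ?k" "breakpoints w ! j < l" "l \<le> breakpoints w ! Suc j"
      using inv_table_row_exists[OF w l] inv_table_col_exists[OF w l] by blast
    then have "l \<in> Phi w $$ (i, j)" using l by (simp add: mem_Phi_iff len)
    then show ?thesis using \<open>i < ?k\<close> \<open>j < ?k\<close> by blast
  qed
  have mem: "l \<in> {1..n}" if "i < ?k" "j < ?k" "l \<in> Phi w $$ (i, j)" for i j l
    using that by (simp add: mem_Phi_iff len)
  \<comment> \<open>An element below the diagonal would satisfy l \<le> y_{j+1} \<le> y_i = x_l <
    l.\<close>
  have upper: "Phi w $$ (i, j) = {}" if "i < ?k" "j < i" for i j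
  proof (rule ccontr)
    assume "Phi w $$ (i, j) \<noteq> {}"
    then obtain l where l: "l \<in> Phi w $$ (i, j)" by blast
    have "l \<le> breakpoints w ! Suc j" using l that by (simp add: mem_Phi_iff)
    also have "\<dots> \<le> breakpoints w ! i" using breakpoints_mono[OF w] that by simp
    also have "\<dots> = w ! (l - 1)" using l that by (simp add: mem_Phi_iff)
    also have "\<dots> < l" using inv_tables_entry[OF w] mem[OF that(1) _ l] that by simp
    finally show False by simp
  qed
  \<comment> \<open>The \<open>i\<close>-th letter occurs in \<open>w\<close> at some list position
    \<open>m\<close>, which puts the element \<open>Suc m\<close> into row \<open>i\<close>.\<close>
  have rows: "\<exists>j<?k. Phi w $$ (i, j) \<noteq> {}" if "i < ?k" for i
  proof -
    have "breakpoints w ! i \<in> set w" using breakpoints_image[of w] that by blast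
    then obtain m where m: "m < n" "w ! m = breakpoints w ! i"
      using len by (auto simp: in_set_conv_nth)
    then obtain j where "j < ?k" "breakpoints w ! j < Suc m" "Suc m \<le> breakpoints w ! Suc j"
      using inv_table_col_exists[OF w, of "Suc m"] by auto
    then have "Suc m \<in> Phi w $$ (i, j)" using m that by (simp add: mem_Phi_iff len)
    then show ?thesis using \<open>j < ?k\<close> by blast
  qed
  have cols: "\<exists>i<?k. Phi w $$ (i, j) \<noteq> {}" if "j < ?k" for j
  proof -
    have "col_union (Phi w) j \<noteq> {}"
      using Phi_col_union[OF w that] breakpoints_strict_mono[OF w, of j "Suc j"] that by simp
    then show ?thesis by (auto simp: col_union_def dim_Phi)
  qed
  have disj: "disjoint_family_on (\<lambda>p. Phi w $$ p) ({..<?k} \<times> {..<?k})"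
  proof (unfold disjoint_family_on_def, clarsimp)
    fix i j i' j' assume "i < ?k" "j < ?k" "i' < ?k" "j' < ?k" "i = i' \<longrightarrow> j \<noteq> j'"
    then show "Phi w $$ (i, j) \<inter> Phi w $$ (i', j') = {}"
      using Phi_index_unique[OF w, of i j _ i' j'] by blast
  qed
  have un: "(\<Union>p\<in>{..<?k} \<times> {..<?k}. Phi w $$ p) = {1..n}"
  proof (intro equalityI subsetI)
    fix l assume "l \<in> (\<Union>p\<in>{..<?k} \<times> {..<?k}. Phi w $$ p)"
    then obtain i j where "i < ?k" "j < ?k" "l \<in> Phi w $$ (i, j)" by blast
    then show "l \<in> {1..n}" by (rule mem)
  next
    fix l assume "l \<in> {1..n}"
    then obtain i j where "i < ?k" "j < ?k" "l \<in> Phi w $$ (i, j)" using cover[of l] by blast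
    then show "l \<in> (\<Union>p\<in>{..<?k} \<times> {..<?k}. Phi w $$ p)" by blast
  qed
  \<comment> \<open>A breakpoint separates different columns: a \<le> y_{j+1} \<le> y_{j'} <
    b.\<close>
  have "a < b" if ab: "a \<in> {1..n}" "b \<in> {1..n}" "col_of (Phi w) a < col_of (Phi w) b" for a b
  proof -
    obtain i j i' j' where ij: "i < ?k" "j < ?k" "a \<in> Phi w $$ (i, j)"
      and ij': "i' < ?k" "j' < ?k" "b \<in> Phi w $$ (i', j')"
      using cover[OF ab(1)] cover[OF ab(2)] by blast
    have "col_of (Phi w) a = j" "col_of (Phi w) b = j'"
      using row_col_of_eq(2)[OF sq, unfolded dim_Phi, OF Phi_index_unique[OF w _ _ _ ij] ij]
        row_col_of_eq(2)[OF sq, unfolded dim_Phi, OF Phi_index_unique[OF w _ _ _ ij'] ij']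
      by simp_all
    then have "Suc j \<le> j'" using ab by simp
    then have "breakpoints w ! Suc j \<le> breakpoints w ! j'"
      using breakpoints_mono[OF w] ij' by simp
    then show "a < b" using ij ij' by (simp add: mem_Phi_iff)
  qed
  then show ?thesis
    using sq upper rows cols disj un by (simp add: Par_def partition_matrix_def dim_Phi)
qed

lemma K_Phi:
  assumes w: "w \<in> inv_tables n"
  shows "K n (Phi w) = w"
proof (rule nth_equalityI)
  show "length (K n (Phi w)) = length w" using w by (simp add: K_def inv_tables_def)
  fix m assume "m < length (K n (Phi w))"
  then have m: "m < n" by (simp add: K_def del: upt_Suc)
  have P: "partition_matrix {1..n} (Phi w)" using Phi_in_Par[OF w] by (simp add: Par_def)
  define i j where "i = row_of (Phi w) (Suc m)" and "j = col_of (Phi w) (Suc m)"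
  have ij: "i < card (set w)" "j < card (set w)"
    using partition_matrix_row_col_bounds[OF P, of "Suc m"] m by (auto simp: i_def j_def dim_Phi)
  then have "Suc m \<in> Phi w $$ (i, j)"
    using partition_matrix_mem_iff[OF P] m by (simp add: i_def j_def dim_Phi)
  then have "w ! m = breakpoints w ! i" using ij by (simp add: mem_Phi_iff)
  \<comment> \<open>Column \<open>i\<close> is an interval open on the left and nonempty by strict
    monotonicity, so its minimum is one more than the letter of row \<open>i\<close>; the
    subtraction in \<open>K\<close> undoes this shift.\<close>
  moreover have "Min (col_union (Phi w) i) = Suc (breakpoints w ! i)"
    using breakpoints_strict_mono[OF w, of i "Suc i"] ij(1)
    by (auto simp: Phi_col_union[OF w ij(1)] intro!: Min_eqI)
  ultimately show "K n (Phi w) ! m = w ! m"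
    using m by (simp add: K_def i_def del: upt_Suc)
qed

subsection \<open>The inversion table of a partition matrix\<close>

text \<open>The matrix counterpart of \<open>breakpoints\<close>. Subtracting 1 makes the columns
  intervals open on the left, and the value \<open>n\<close> beyond the last column matches the
  appended length.\<close>

definition col_start :: "nat \<Rightarrow> nat set mat \<Rightarrow> nat \<Rightarrow> nat" where
  "col_start n A j = (if j < dim_row A then Min (col_union A j) - 1 else n)"

text \<open>Since the order of columns agrees with the order of their elements, the minimum of
  column \<open>j\<close> separates the columns before \<open>j\<close> from the rest. The facts
  about \<open>col_start\<close> below rest on this equivalence.\<close>

lemma col_start_less_iff:
  assumes A: "A \<in> Par n" and "j < dim_row A" and "l \<in> {1..n}"
  shows "col_start n A j < l \<longleftrightarrow> j \<le> col_of A l"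
proof -
  have P: "partition_matrix {1..n} A" using A by (simp add: Par_def)
  have ord: "a < b" if "a \<in> {1..n}" "b \<in> {1..n}" "col_of A a < col_of A b" for a b
    using partition_matrixD(7)[OF P that] .
  let ?C = "{l \<in> {1..n}. col_of A l = j}"
  have fin: "finite ?C" by simp
  have "?C \<noteq> {}" using partition_matrix_col_nonempty[OF P assms(2)] by blast
  then have m: "Min ?C \<in> {1..n}" "col_of A (Min ?C) = j"
    using Min_in[OF fin] by blast+
  have "col_start n A j = Min ?C - 1"
    by (simp only: col_start_def partition_matrix_col_union[OF P assms(2)] assms(2) if_True)
  \<comment> \<open>The minimum is at least 1, so the truncated subtraction is exact.\<close>
  then have "col_start n A j < l \<longleftrightarrow> Min ?C \<le> l" using m(1) by auto
  also have "\<dots> \<longleftrightarrow> j \<le> col_of A l"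
  proof
    assume "Min ?C \<le> l"
    then show "j \<le> col_of A l" using ord[OF assms(3) m(1)] m(2) by linarith
  next
    assume "j \<le> col_of A l"
    then consider "col_of A l = j" | "j < col_of A l" by linarith
    then show "Min ?C \<le> l"
    proof cases
      case 1
      then show ?thesis using Min_le[OF fin] assms(3) by blast
    next
      case 2
      then show ?thesis using ord[OF m(1) assms(3)] m(2) by simp
    qed
  qed
  finally show ?thesis .
qed

text \<open>Being in column \<open>j\<close> means having column index at least \<open>j\<close> but
  not at least \<open>Suc j\<close>. For the last column the upper bound is the default value
  \<open>n\<close>.\<close>

lemma col_of_eq_iff:
  assumes A: "A \<in> Par n" and "j < dim_row A" and "l \<in> {1..n}"
  shows "col_of A l = j \<longleftrightarrow> col_start n A j < l \<and> l \<le> col_start n A (Suc j)"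
proof (cases "Suc j < dim_row A")
  case True
  then show ?thesis
    using col_start_less_iff[OF A assms(2,3)] col_start_less_iff[OF A True assms(3)] by auto
next
  case False
  moreover have "col_of A l < dim_row A"
    using A partition_matrix_row_col_bounds(2) assms(3) by (auto simp: Par_def)
  ultimately show ?thesis
    using col_start_less_iff[OF A assms(2,3)] assms(2,3) by (auto simp: col_start_def)
qed

text \<open>Any element of the nonempty column \<open>i\<close> lies above the start of column
  \<open>i\<close> and not above the start of column \<open>j\<close>.\<close>

lemma col_start_strict_mono:
  assumes A: "A \<in> Par n" and "i < j" "j < dim_row A"
  shows "col_start n A i < col_start n A j"
proof -
  have P: "partition_matrix {1..n} A" using A by (simp add: Par_def)
  obtain l where l: "l \<in> {1..n}" "col_of A l = i"
    using partition_matrix_col_nonempty[OF P, of i] assms by auto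
  then have "col_start n A i < l" "\<not> col_start n A j < l"
    using col_start_less_iff[OF A _ l(1)] assms by auto
  then show ?thesis by simp
qed

lemma K_nth:
  assumes A: "A \<in> Par n" and "l \<in> {1..n}"
  shows "K n A ! (l - 1) = col_start n A (row_of A l)"
proof -
  have "row_of A l < dim_row A"
    using A partition_matrix_row_col_bounds[of "{1..n}" A l] assms(2) by (auto simp: Par_def)
  then show ?thesis using assms(2) by (auto simp: K_def col_start_def simp del: upt_Suc)
qed

lemma K_in_inv_tables:
  assumes A: "A \<in> Par n"
  shows "K n A \<in> inv_tables n"
proof -
  have "K n A ! (l - 1) \<le> l - 1" if l: "l \<in> {1..n}" for l
  proof -
    have "row_of A l \<le> col_of A l" "col_of A l < dim_row A"
      using A l partition_matrix_row_col_bounds[of "{1..n}" A l] by (auto simp: Par_def)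
    \<comment> \<open>Here triangularity enters: row \<le> column says that \<open>l\<close> lies
      beyond the start of the column indexed by its row.\<close>
    then have "col_start n A (row_of A l) < l"
      using col_start_less_iff[OF A _ l] by simp
    then show ?thesis unfolding K_nth[OF A l] by linarith
  qed
  then show ?thesis by (simp add: inv_tables_def K_def del: upt_Suc)
qed

text \<open>Every row is nonempty, so every column start occurs as an entry of \<open>K n A\<close>.
  The starts increase strictly, so sorting the alphabet lists them in column order.\<close>

lemma breakpoints_K:
  assumes A: "A \<in> Par n"
  shows "breakpoints (K n A) = map (col_start n A) [0..<Suc (dim_row A)]"
proof -
  have P: "partition_matrix {1..n} A" using A by (simp add: Par_def)
  have "set (K n A) = (\<lambda>l. K n A ! (l - 1)) ` {1..n}"
    by (force simp: K_def simp del: upt_Suc)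
  also have "\<dots> = col_start n A ` row_of A ` {1..n}"
    using K_nth[OF A] by (simp add: image_image)
  also have "row_of A ` {1..n} = {..<dim_row A}"
  proof
    show "row_of A ` {1..n} \<subseteq> {..<dim_row A}"
      using partition_matrix_row_col_bounds[OF P] by fastforce
    show "{..<dim_row A} \<subseteq> row_of A ` {1..n}"
      using partition_matrix_row_nonempty[OF P] by blast
  qed
  also have "col_start n A ` {..<dim_row A} = set (map (col_start n A) [0..<dim_row A])"
    by (simp add: lessThan_atLeast0)
  finally have set_eq: "set (K n A) = set (map (col_start n A) [0..<dim_row A])" .
  have "sorted_wrt (<) (map (col_start n A) [0..<dim_row A])"
    using col_start_strict_mono[OF A] by (simp add: sorted_wrt_iff_nth_less)
  then have "sorted_list_of_set (set (K n A)) = map (col_start n A) [0..<dim_row A]"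
    unfolding set_eq by (simp only: sorted_list_of_set.idem_if_sorted_distinct strict_sorted_iff)
  then show ?thesis by (simp add: breakpoints_def K_def col_start_def del: upt_Suc) (simp add: col_start_def)
qed

lemma Phi_K:
  assumes A: "A \<in> Par n"
  shows "Phi (K n A) = A"
proof -
  let ?w = "K n A"
  have P: "partition_matrix {1..n} A" using A by (simp add: Par_def)
  have len: "length ?w = n" by (simp add: K_def)
  \<comment> \<open>Comparing lengths shows that the alphabet has as many letters as
    \<open>A\<close> has rows, so both matrices have the same size.\<close>
  have "length (breakpoints ?w) = Suc (dim_row A)" by (simp add: breakpoints_K[OF A])
  then have card: "card (set ?w) = dim_row A" by (simp add: breakpoints_def)
  have br: "breakpoints ?w ! i = col_start n A i" if "i \<le> dim_row A" for i
    using that by (simp add: breakpoints_K[OF A] del: upt_Suc)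
  have sq: "dim_col A = dim_row A" using partition_matrixD(1)[OF P] .
  show ?thesis
  proof (rule eq_matI)
    fix i j assume "i < dim_row A" "j < dim_col A"
    then have ij: "i < dim_row A" "j < dim_row A" by (simp_all add: sq)
    show "Phi ?w $$ (i, j) = A $$ (i, j)"
    proof (rule Set.set_eqI)
      fix l
      \<comment> \<open>Strict monotonicity makes \<open>col_start\<close> injective on row indices,
        so the letter at \<open>l\<close> determines its row.\<close>
      have row: "col_start n A (row_of A l) = col_start n A i \<longleftrightarrow> row_of A l = i" if "l \<in> {1..n}"
        using col_start_strict_mono[OF A, of "row_of A l" i]
          col_start_strict_mono[OF A, of i "row_of A l"]
          partition_matrix_row_col_bounds[OF P that] ij
        by (cases "row_of A l" i rule: linorder_cases) auto
      have "l \<in> Phi ?w $$ (i, j) \<longleftrightarrow> l \<in> {1..n} \<and> ?w ! (l - 1) = col_start n A i \<and>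
          col_start n A j < l \<and> l \<le> col_start n A (Suc j)"
        using ij by (simp add: mem_Phi_iff card len br)
      also have "\<dots> \<longleftrightarrow> l \<in> {1..n} \<and> row_of A l = i \<and> col_of A l = j"
        using row K_nth[OF A] col_of_eq_iff[OF A ij(2)] by auto
      also have "\<dots> \<longleftrightarrow> l \<in> A $$ (i, j)"
        using partition_matrix_mem_iff[OF P ij] by simp
      finally show "l \<in> Phi ?w $$ (i, j) \<longleftrightarrow> l \<in> A $$ (i, j)" .
    qed
  qed (simp_all add: dim_Phi card sq)
qed

theorem theorem3:
  fixes n :: nat
  assumes "n \<ge> 1"
  shows "bij_betw Phi (inv_tables n) (Par n) \<and>
         K n \<in> Par n \<rightarrow> inv_tables n \<and>
         (\<forall>w\<in>inv_tables n. K n (Phi w) = w) \<and>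
         (\<forall>A\<in>Par n. Phi (K n A) = A)"
proof -
  have "bij_betw Phi (inv_tables n) (Par n)"
    using Phi_in_Par K_in_inv_tables K_Phi Phi_K
    by (intro bij_betw_byWitness[where f' = "K n"]) auto
  then show ?thesis using K_in_inv_tables K_Phi Phi_K by auto
qed

end
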